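(* Let $A\in\mathcal W(E)$ with representation $A=\sum_{j\in G}M_{b^{(j)}}V_j$, where $(b^{(j)})_{j\in G}\subset\ell^\infty(G,L(Y))$ and $\|A\|_{\mathcal W}=\sum_{j\in G}\|b^{(j)}\|_\infty<\infty$. Let $W\subset G$ be a finite set and let $w\in\ell^2(G)$ with $w\neq 0$ and $\operatorname{supp} w\subset W$. For $k\in G$ let $A_k:=AP_k$ (acting on $\ell^2(k+W,Y)$), and for $x\in E$ let $\tilde x_k:=M_{V_kw}x$, i.e. $(\tilde x_k)_i=w_{i-k}x_i$ for $i\in G$. Then for every nonzero $x\in E$ there exists a $k\in G$ such that $\tilde x_k\neq 0$ and $$\frac{\|A_k\tilde x_k\|}{\|\tilde x_k\|}\ \le\ \frac{\|Ax\|}{\|x\|}+\varepsilon(w,A),\qquad\text{where}\qquad \varepsilon(w,A):=\sum_{j\in G}\|b^{(j)}\|_\infty\,\frac{\|V_jw-w\|_2}{\|w\|_2}.$$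
   Context: $(G,+)$ is a countable Abelian group with counting measure, $Y$ is a complex Hilbert space, $E:=\ell^2(G,Y)$, $\ell^2(G):=\ell^2(G,\mathbb C)$, and $L(Y)$ is the algebra of bounded linear operators on $Y$. For $b\in\ell^\infty(G,L(Y))$ (or a bounded scalar function $b$ on $G$), $M_b$ is the multiplication operator $(M_bx)_i=b_ix_i$; $\|b\|_\infty=\sup_i\|b_i\|$. For $j\in G$, $V_j$ is the shift $(V_jx)_i=x_{i-j}$ (on $E$ and on $\ell^2(G)$). The Wiener algebra $\mathcal W(E)$ is the set of all operators $A=\sum_{j\in G}M_{b^{(j)}}V_j$ with $\|A\|_{\mathcal W}:=\sum_{j\in G}\|b^{(j)}\|_\infty<\infty$. For $k\in G$, $P_k$ is the operator of multiplication by the characteristic function of $k+W$; its range is identified with $\ell^2(k+W,Y)$. $\operatorname{supp}x=\{i:x_i\neq0\}$. *)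

theory Defs
  imports "HOL-Analysis.Analysis"
begin

section \<open>Complex Hilbert spaces\<close>

text \<open>The sesquilinear form is taken to be linear in its first argument. Together with
  \<open>cinner_self\<close>, positive definiteness is inherited from the norm.\<close>

class complex_inner = real_normed_vector +
  fixes scaleC :: "complex \<Rightarrow> 'a \<Rightarrow> 'a"
    and cinner :: "'a \<Rightarrow> 'a \<Rightarrow> complex"
  assumes scaleC_add_right: "scaleC c (x + y) = scaleC c x + scaleC c y"
    and scaleC_add_left: "scaleC (c + d) x = scaleC c x + scaleC d x"
    and scaleC_scaleC: "scaleC c (scaleC d x) = scaleC (c * d) x"
    and scaleC_of_real: "scaleC (complex_of_real r) x = scaleR r x"
    and cinner_add_left: "cinner (x + y) z = cinner x z + cinner y z"
    and cinner_scaleC_left: "cinner (scaleC c x) y = c * cinner x y"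
    and cinner_commute: "cinner x y = cnj (cinner y x)"
    and cinner_self: "cinner x x = complex_of_real ((norm x)\<^sup>2)"

class complex_hilbert = complex_inner + banach

instantiation complex :: complex_hilbert
begin

definition scaleC_complex :: "complex \<Rightarrow> complex \<Rightarrow> complex"
  where "scaleC_complex c x = c * x"

definition cinner_complex :: "complex \<Rightarrow> complex \<Rightarrow> complex"
  where "cinner_complex x y = x * cnj y"

instance
proof
  fix c d x y z :: complex and r :: real
  show "scaleC c (x + y) = scaleC c x + scaleC c y" "scaleC (c + d) x = scaleC c x + scaleC d x"
    "scaleC c (scaleC d x) = scaleC (c * d) x"
    by (simp_all add: scaleC_complex_def distrib_left distrib_right)
  show "scaleC (complex_of_real r) x = scaleR r x"
    by (simp add: scaleC_complex_def scaleR_conv_of_real)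
  show "cinner (x + y) z = cinner x z + cinner y z" "cinner (scaleC c x) y = c * cinner x y"
    "cinner x y = cnj (cinner y x)"
    by (simp_all add: cinner_complex_def scaleC_complex_def distrib_right)
  show "cinner x x = complex_of_real ((norm x)\<^sup>2)"
    unfolding cinner_complex_def by (rule complex_norm_square[symmetric])
qed

end

lemma norm_scaleC: "norm (scaleC c x) = cmod c * norm x" for x :: "'y::complex_inner"
proof -
  have "complex_of_real ((norm (scaleC c x))\<^sup>2) = c * cnj (c * cinner x x)"
    by (metis cinner_self cinner_scaleC_left cinner_commute)
  also have "\<dots> = complex_of_real ((cmod c * norm x)\<^sup>2)"
    by (simp add: cinner_self power_mult_distrib mult.assoc[symmetric] flip: complex_norm_square)
  finally have "(norm (scaleC c x))\<^sup>2 = (cmod c * norm x)\<^sup>2"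
    using of_real_eq_iff by blast
  then show ?thesis
    by (simp add: power2_eq_iff_nonneg)
qed

text \<open>\<open>L(Y)\<close>: the (real-linear) bounded operators that are complex linear. The library's operator
  norm does not depend on the scalar field.\<close>

definition clinear_ops :: "('y::complex_inner \<Rightarrow>\<^sub>L 'y) set"
  where "clinear_ops = {T. \<forall>c y. blinfun_apply T (scaleC c y) = scaleC c (blinfun_apply T y)}"

definition scalar_op :: "complex \<Rightarrow> 'y::complex_inner \<Rightarrow>\<^sub>L 'y"
  where "scalar_op c = Blinfun (scaleC c)"

lemma bounded_linear_scaleC: "bounded_linear (scaleC c :: 'y::complex_inner \<Rightarrow> 'y)"
proof (rule bounded_linear_intro[where K = "cmod c"])
  show "scaleC c (x + y) = scaleC c x + scaleC c y" for x y :: 'y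
    by (rule scaleC_add_right)
  show "scaleC c (scaleR r x) = scaleR r (scaleC c x)" for r and x :: 'y
    by (simp add: scaleC_scaleC mult.commute flip: scaleC_of_real)
  show "norm (scaleC c x) \<le> norm x * cmod c" for x :: 'y
    by (simp add: norm_scaleC)
qed

lemma scalar_op_apply [simp]: "blinfun_apply (scalar_op c) y = scaleC c y"
  by (simp add: scalar_op_def bounded_linear_Blinfun_apply[OF bounded_linear_scaleC])


section \<open>The space \<open>\<ell>\<^sup>2(G, Y)\<close>\<close>

definition square_summable :: "('g \<Rightarrow> 'y::real_normed_vector) \<Rightarrow> bool"
  where "square_summable f \<longleftrightarrow> (\<lambda>i. (norm (f i))\<^sup>2) summable_on UNIV"

definition norm2 :: "('g \<Rightarrow> 'y::real_normed_vector) \<Rightarrow> real"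
  where "norm2 f = sqrt (\<Sum>\<^sub>\<infinity>i. (norm (f i))\<^sup>2)"

lemma norm2_nonneg [simp]: "0 \<le> norm2 f"
  by (simp add: norm2_def infsum_nonneg)

lemma L2_set_le_norm2:
  assumes "square_summable f" "finite F"
  shows "L2_set (\<lambda>i. norm (f i)) F \<le> norm2 f"
  unfolding L2_set_def norm2_def
  by (intro real_sqrt_le_mono finite_sum_le_infsum)
    (use assms in \<open>auto simp: square_summable_def\<close>)

lemma square_summable_bound:
  assumes "\<And>F. finite F \<Longrightarrow> L2_set (\<lambda>i. norm (f i)) F \<le> B"
  shows "square_summable f" and "norm2 f \<le> B"
proof -
  have B: "0 \<le> B"
    using assms[of "{}"] by simp
  have *: "(\<Sum>i\<in>F. (norm (f i))\<^sup>2) \<le> B\<^sup>2" if "finite F" for F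
  proof -
    have "sqrt (\<Sum>i\<in>F. (norm (f i))\<^sup>2) \<le> B"
      using assms[OF that] by (simp add: L2_set_def)
    then show ?thesis
      using sqrt_le_D by blast
  qed
  show s: "square_summable f"
    unfolding square_summable_def
    by (rule nonneg_bdd_above_summable_on) (use * in \<open>auto intro!: bdd_aboveI[where M = "B\<^sup>2"]\<close>)
  have "(\<Sum>\<^sub>\<infinity>i. (norm (f i))\<^sup>2) \<le> B\<^sup>2"
    by (rule infsum_le_finite_sums) (use s * in \<open>auto simp: square_summable_def\<close>)
  then show "norm2 f \<le> B"
    unfolding norm2_def using B by (simp add: real_le_lsqrt)
qed

lemma square_summable_add_aux:
  assumes "square_summable f" "square_summable g"
  shows "square_summable (\<lambda>i. f i + g i)" and "norm2 (\<lambda>i. f i + g i) \<le> norm2 f + norm2 g"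
proof -
  have "L2_set (\<lambda>i. norm (f i + g i)) F \<le> norm2 f + norm2 g" if "finite F" for F
  proof -
    have "L2_set (\<lambda>i. norm (f i + g i)) F \<le> L2_set (\<lambda>i. norm (f i) + norm (g i)) F"
      by (intro L2_set_mono) (auto simp: norm_triangle_ineq)
    also have "\<dots> \<le> L2_set (\<lambda>i. norm (f i)) F + L2_set (\<lambda>i. norm (g i)) F"
      by (rule L2_set_triangle_ineq)
    also have "\<dots> \<le> norm2 f + norm2 g"
      by (intro add_mono L2_set_le_norm2 assms that)
    finally show ?thesis .
  qed
  note * = this
  show "square_summable (\<lambda>i. f i + g i)" "norm2 (\<lambda>i. f i + g i) \<le> norm2 f + norm2 g"
    by (rule square_summable_bound[OF *]; assumption)+
qed

lemma square_summable_dominated: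
  assumes f: "square_summable f" and K: "0 \<le> K" and le: "\<And>i. norm (g i) \<le> K * norm (f i)"
  shows "square_summable g" and "norm2 g \<le> K * norm2 f"
proof -
  have "L2_set (\<lambda>i. norm (g i)) F \<le> K * norm2 f" if "finite F" for F
  proof -
    have "L2_set (\<lambda>i. norm (g i)) F \<le> L2_set (\<lambda>i. K * norm (f i)) F"
      by (intro L2_set_mono) (auto simp: le)
    also have "\<dots> = K * L2_set (\<lambda>i. norm (f i)) F"
      using K by (simp add: L2_set_right_distrib)
    also have "\<dots> \<le> K * norm2 f"
      by (intro mult_left_mono L2_set_le_norm2 f that K)
    finally show ?thesis .
  qed
  note * = this
  show "square_summable g" "norm2 g \<le> K * norm2 f"
    by (rule square_summable_bound[OF *]; assumption)+
qed

lemma square_summable_zero: "square_summable (\<lambda>i. 0)"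
  by (simp add: square_summable_def)

lemma square_summable_scaleR: "square_summable f \<Longrightarrow> square_summable (\<lambda>i. r *\<^sub>R f i)"
  by (rule square_summable_dominated[where K = "\<bar>r\<bar>"]) auto

lemma norm2_eq_0_iff:
  assumes "square_summable f"
  shows "norm2 f = 0 \<longleftrightarrow> f = (\<lambda>i. 0)"
proof
  assume 0: "norm2 f = 0"
  have "norm (f i) \<le> 0" for i
    using L2_set_le_norm2[OF assms, of "{i}"] 0 by simp
  then show "f = (\<lambda>i. 0)"
    by auto
qed (simp add: norm2_def)

typedef (overloaded) ('g, 'y) ell2 = "{f :: 'g \<Rightarrow> 'y::real_normed_vector. square_summable f}"
  using square_summable_zero by auto

setup_lifting type_definition_ell2

instantiation ell2 :: (type, real_normed_vector) real_normed_vector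
begin

lift_definition zero_ell2 :: "('a, 'b) ell2" is "\<lambda>i. 0"
  by (rule square_summable_zero)

lift_definition plus_ell2 :: "('a, 'b) ell2 \<Rightarrow> ('a, 'b) ell2 \<Rightarrow> ('a, 'b) ell2"
  is "\<lambda>f g i. f i + g i"
  by (rule square_summable_add_aux)

lift_definition scaleR_ell2 :: "real \<Rightarrow> ('a, 'b) ell2 \<Rightarrow> ('a, 'b) ell2"
  is "\<lambda>r f i. r *\<^sub>R f i"
  by (rule square_summable_scaleR)

lift_definition uminus_ell2 :: "('a, 'b) ell2 \<Rightarrow> ('a, 'b) ell2" is "\<lambda>f i. - f i"
  by (simp add: square_summable_def)

lift_definition minus_ell2 :: "('a, 'b) ell2 \<Rightarrow> ('a, 'b) ell2 \<Rightarrow> ('a, 'b) ell2"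
  is "\<lambda>f g i. f i - g i"
proof -
  fix f g :: "'a \<Rightarrow> 'b"
  assume f: "square_summable f" and g: "square_summable g"
  have "square_summable (\<lambda>i. - g i)"
    using g by (simp add: square_summable_def)
  from square_summable_add_aux(1)[OF f this] show "square_summable (\<lambda>i. f i - g i)"
    by simp
qed

lift_definition norm_ell2 :: "('a, 'b) ell2 \<Rightarrow> real" is norm2 .

definition dist_ell2 :: "('a, 'b) ell2 \<Rightarrow> ('a, 'b) ell2 \<Rightarrow> real"
  where "dist_ell2 x y = norm (x - y)"

definition sgn_ell2 :: "('a, 'b) ell2 \<Rightarrow> ('a, 'b) ell2"
  where "sgn_ell2 x = scaleR (inverse (norm x)) x"

definition uniformity_ell2 :: "(('a, 'b) ell2 \<times> ('a, 'b) ell2) filter"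
  where "uniformity_ell2 = (INF e\<in>{0<..}. principal {(x, y). dist x y < e})"

definition open_ell2 :: "('a, 'b) ell2 set \<Rightarrow> bool"
  where "open_ell2 U = (\<forall>x\<in>U. \<forall>\<^sub>F (x', y) in uniformity. x' = x \<longrightarrow> y \<in> U)"

instance
proof
  fix x y z :: "('a, 'b) ell2" and a b :: real
  show "x + y + z = x + (y + z)" "x + y = y + x" "0 + x = x" "- x + x = 0" "x - y = x + - y"
    "a *\<^sub>R (x + y) = a *\<^sub>R x + a *\<^sub>R y" "(a + b) *\<^sub>R x = a *\<^sub>R x + b *\<^sub>R x"
    "a *\<^sub>R b *\<^sub>R x = (a * b) *\<^sub>R x" "1 *\<^sub>R x = x"
    by (transfer; simp add: algebra_simps)+
  show "dist x y = norm (x - y)"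
    by (rule dist_ell2_def)
  show "sgn x = inverse (norm x) *\<^sub>R x"
    by (rule sgn_ell2_def)
  show "uniformity = (INF e\<in>{0<..}. principal {(x :: ('a, 'b) ell2, y). dist x y < e})"
    by (rule uniformity_ell2_def)
  show "open U = (\<forall>x\<in>U. \<forall>\<^sub>F (x', y) in uniformity. x' = x \<longrightarrow> y \<in> U)"
    for U :: "('a, 'b) ell2 set"
    by (rule open_ell2_def)
  show "norm x = 0 \<longleftrightarrow> x = 0"
    by transfer (rule norm2_eq_0_iff)
  show "norm (x + y) \<le> norm x + norm y"
    by transfer (rule square_summable_add_aux)
  show "norm (a *\<^sub>R x) = \<bar>a\<bar> * norm x"
    by transfer (simp add: norm2_def power_mult_distrib infsum_cmult_right' real_sqrt_mult)
qed

end

definition supp :: "('g, 'y::real_normed_vector) ell2 \<Rightarrow> 'g set"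
  where "supp x = {i. Rep_ell2 x i \<noteq> 0}"


section \<open>Multiplication and shift operators\<close>

text \<open>Both are defined by \<open>Blinfun\<close>; the two \<open>apply\<close> lemmas below establish that the defining
  functions really are bounded operators (for multiplication, when \<open>b\<close> is bounded).\<close>

definition mult_op :: "('g \<Rightarrow> 'y \<Rightarrow>\<^sub>L 'y) \<Rightarrow> ('g, 'y::real_normed_vector) ell2 \<Rightarrow>\<^sub>L ('g, 'y) ell2"
  where "mult_op b = Blinfun (\<lambda>x. Abs_ell2 (\<lambda>i. blinfun_apply (b i) (Rep_ell2 x i)))"

definition shift_op :: "'g::ab_group_add \<Rightarrow> ('g, 'y::real_normed_vector) ell2 \<Rightarrow>\<^sub>L ('g, 'y) ell2"
  where "shift_op j = Blinfun (\<lambda>x. Abs_ell2 (\<lambda>i. Rep_ell2 x (i - j)))"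

lemma mult_op_apply:
  fixes b :: "'g \<Rightarrow> 'y::real_normed_vector \<Rightarrow>\<^sub>L 'y"
  assumes "bounded (range b)"
  shows "Rep_ell2 (blinfun_apply (mult_op b) x) i = blinfun_apply (b i) (Rep_ell2 x i)"
proof -
  obtain K where K: "\<And>i. norm (b i) \<le> K"
    using assms by (auto simp: bounded_iff)
  have K0: "0 \<le> K"
    using K[of undefined] norm_ge_zero order_trans by blast
  have le: "norm (blinfun_apply (b i) (Rep_ell2 x i)) \<le> K * norm (Rep_ell2 x i)" for i x
    by (rule order_trans[OF norm_blinfun mult_right_mono[OF K]]) simp
  have ss: "square_summable (Rep_ell2 x)" for x :: "('g, 'y) ell2"
    using Rep_ell2[of x] by simp
  define f where "f x = Abs_ell2 (\<lambda>i. blinfun_apply (b i) (Rep_ell2 x i))" for x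
  have f: "Rep_ell2 (f x) = (\<lambda>i. blinfun_apply (b i) (Rep_ell2 x i))" for x
    unfolding f_def
    by (rule Abs_ell2_inverse) (use square_summable_dominated(1)[OF ss K0 le] in simp)
  have "bounded_linear f"
  proof (rule bounded_linear_intro[where K = K])
    show "f (x + y) = f x + f y" for x y
      by (rule Rep_ell2_inject[THEN iffD1]) (simp add: f plus_ell2.rep_eq blinfun.add_right)
    show "f (r *\<^sub>R x) = r *\<^sub>R f x" for r x
      by (rule Rep_ell2_inject[THEN iffD1]) (simp add: f scaleR_ell2.rep_eq blinfun.scaleR_right)
    show "norm (f x) \<le> norm x * K" for x
      using square_summable_dominated(2)[OF ss K0 le] by (simp add: norm_ell2.rep_eq f mult.commute)
  qed
  then have "blinfun_apply (mult_op b) x = f x"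
    unfolding mult_op_def f_def[symmetric] by (simp add: bounded_linear_Blinfun_apply)
  then show ?thesis
    by (simp add: f)
qed

lemma shift_op_apply:
  "Rep_ell2 (blinfun_apply (shift_op j) x) i = Rep_ell2 x (i - j)"
  for x :: "('g::ab_group_add, 'y::real_normed_vector) ell2"
proof -
  have bij: "bij_betw (\<lambda>i. i - j) UNIV UNIV"
    by (rule bij_betw_byWitness[where f' = "\<lambda>i. i + j"]) auto
  have ss: "square_summable (Rep_ell2 x)" for x :: "('g, 'y) ell2"
    using Rep_ell2[of x] by simp
  have ss': "square_summable (\<lambda>i. Rep_ell2 x (i - j))" for x :: "('g, 'y) ell2"
    using ss[of x] summable_on_reindex_bij_betw[OF bij, of "\<lambda>i. (norm (Rep_ell2 x i))\<^sup>2"]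
    by (simp add: square_summable_def)
  have n: "norm2 (\<lambda>i. Rep_ell2 x (i - j)) = norm2 (Rep_ell2 x)" for x :: "('g, 'y) ell2"
    using infsum_reindex_bij_betw[OF bij, of "\<lambda>i. (norm (Rep_ell2 x i))\<^sup>2"]
    by (simp add: norm2_def)
  define f where "f x = Abs_ell2 (\<lambda>i. Rep_ell2 x (i - j))" for x :: "('g, 'y) ell2"
  have f: "Rep_ell2 (f x) = (\<lambda>i. Rep_ell2 x (i - j))" for x
    unfolding f_def by (rule Abs_ell2_inverse) (use ss' in simp)
  have "bounded_linear f"
  proof (rule bounded_linear_intro[where K = 1])
    show "f (x + y) = f x + f y" for x y
      by (rule Rep_ell2_inject[THEN iffD1]) (simp add: f plus_ell2.rep_eq)
    show "f (r *\<^sub>R x) = r *\<^sub>R f x" for r x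
      by (rule Rep_ell2_inject[THEN iffD1]) (simp add: f scaleR_ell2.rep_eq)
    show "norm (f x) \<le> norm x * 1" for x
      by (simp add: norm_ell2.rep_eq f n)
  qed
  then have "blinfun_apply (shift_op j) x = f x"
    unfolding shift_op_def f_def[symmetric] by (simp add: bounded_linear_Blinfun_apply)
  then show ?thesis
    by (simp add: f)
qed

text \<open>Multiplication by a bounded scalar function.\<close>

definition scalar_mult_op ::
    "('g \<Rightarrow> complex) \<Rightarrow> ('g, 'y::complex_inner) ell2 \<Rightarrow>\<^sub>L ('g, 'y) ell2"
  where "scalar_mult_op c = mult_op (\<lambda>i. scalar_op (c i))"

lemma scalar_mult_op_apply:
  fixes x :: "('g, 'y::complex_inner) ell2"
  assumes "bounded (range c)"
  shows "Rep_ell2 (blinfun_apply (scalar_mult_op c) x) i = scaleC (c i) (Rep_ell2 x i)"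
proof -
  obtain K where K: "\<And>i. cmod (c i) \<le> K"
    using assms by (auto simp: bounded_iff)
  have "norm (scalar_op (c i) :: 'y \<Rightarrow>\<^sub>L 'y) \<le> K" for i
    by (rule norm_blinfun_bound)
      (use K[of i] order_trans[OF norm_ge_zero K[of i]] in \<open>auto simp: norm_scaleC mult_right_mono\<close>)
  then have "bounded (range (\<lambda>i. scalar_op (c i) :: 'y \<Rightarrow>\<^sub>L 'y))"
    by (auto simp: bounded_iff)
  then show ?thesis
    by (simp add: scalar_mult_op_def mult_op_apply)
qed

lemma bounded_range_ell2: "bounded (range (Rep_ell2 w))"
proof -
  have "norm (Rep_ell2 w i) \<le> norm w" for i
    using L2_set_le_norm2[of "Rep_ell2 w" "{i}"] Rep_ell2[of w] by (simp add: norm_ell2.rep_eq)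
  then show ?thesis
    by (auto simp: bounded_iff)
qed

text \<open>\<open>P\<^sub>k\<close>, the multiplication by the characteristic function of \<open>k + W\<close>.\<close>

definition proj_op ::
    "'g::ab_group_add set \<Rightarrow> 'g \<Rightarrow> ('g, 'y::complex_inner) ell2 \<Rightarrow>\<^sub>L ('g, 'y) ell2"
  where "proj_op W k = scalar_mult_op (indicator ((+) k ` W))"

text \<open>The range of \<open>P\<^sub>k\<close> is the copy of \<open>\<ell>\<^sup>2(k + W, Y)\<close> inside \<open>\<ell>\<^sup>2(G, Y)\<close>.\<close>

lemma range_proj_op:
  "range (blinfun_apply (proj_op W k)) = {x :: ('g::ab_group_add, 'y::complex_inner) ell2.
     supp x \<subseteq> (+) k ` W}"
proof -
  have b: "bounded (range (indicator ((+) k ` W) :: 'g \<Rightarrow> complex))"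
    by (auto simp: bounded_iff indicator_def intro!: exI[of _ 1])
  have s: "scaleC 0 y = 0" "scaleC 1 y = y" for y :: 'y
    using scaleC_of_real[of 0 y] scaleC_of_real[of 1 y] by simp_all
  have P: "Rep_ell2 (blinfun_apply (proj_op W k) x) i =
      (if i \<in> (+) k ` W then Rep_ell2 x i else 0)" for x :: "('g, 'y) ell2" and i
    unfolding proj_op_def scalar_mult_op_apply[OF b] by (simp add: indicator_def s)
  have "x = blinfun_apply (proj_op W k) x" if "supp x \<subseteq> (+) k ` W" for x :: "('g, 'y) ell2"
    by (rule Rep_ell2_inject[THEN iffD1], rule ext) (use that in \<open>auto simp: P supp_def\<close>)
  then show ?thesis
    by (auto simp: supp_def P split: if_splits)
qed


section \<open>The Wiener algebra\<close>

definition linf :: "('g \<Rightarrow> 'y::complex_inner \<Rightarrow>\<^sub>L 'y) set"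
  where "linf = {b. range b \<subseteq> clinear_ops \<and> bounded (range b)}"

definition linf_norm :: "('g \<Rightarrow> 'y::complex_inner \<Rightarrow>\<^sub>L 'y) \<Rightarrow> real"
  where "linf_norm b = (SUP i. norm (b i))"

text \<open>\<open>A = \<Sum>\<^sub>j M\<^bsub>b j\<^esub> V\<^sub>j\<close>, where the series converges in operator norm.\<close>

definition wiener_rep ::
    "(('g::ab_group_add, 'y::complex_inner) ell2 \<Rightarrow>\<^sub>L ('g, 'y) ell2) \<Rightarrow> ('g \<Rightarrow> 'g \<Rightarrow> 'y \<Rightarrow>\<^sub>L 'y) \<Rightarrow> bool"
  where "wiener_rep A b \<longleftrightarrow>
    (\<forall>j. b j \<in> linf) \<and>
    (\<lambda>j. linf_norm (b j)) summable_on UNIV \<and>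
    ((\<lambda>j. mult_op (b j) o\<^sub>L shift_op j) has_sum A) UNIV"

definition wiener_eps ::
    "('g::ab_group_add, complex) ell2 \<Rightarrow> ('g \<Rightarrow> 'g \<Rightarrow> 'y::complex_inner \<Rightarrow>\<^sub>L 'y) \<Rightarrow> real"
  where "wiener_eps w b =
    (\<Sum>\<^sub>\<infinity>j. linf_norm (b j) * (norm (blinfun_apply (shift_op j) w - w) / norm w))"

end

theory Submission
  imports Defs
begin

text \<open>The proof is an averaging argument: the quotients \<open>\<parallel>A (M\<^bsub>V\<^sub>k w\<^esub> x)\<parallel> / \<parallel>M\<^bsub>V\<^sub>k w\<^esub> x\<parallel>\<close> cannot all be large,
  because they are not large on average over the position \<open>k\<close> of the window.

  Summing squares over \<open>k\<close> makes the windows disappear: \<open>\<Sum>\<^sub>k \<parallel>M\<^bsub>V\<^sub>k u\<^esub> x\<parallel>\<^sup>2 = \<parallel>u\<parallel>\<^sup>2 \<parallel>x\<parallel>\<^sup>2\<close> for all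
  \<open>u \<in> \<ell>\<^sup>2(G)\<close> and \<open>x \<in> E\<close> (lemma \<open>has_sum_norm_localize_sq\<close>). Moreover \<open>A\<close> almost commutes with
  \<open>M\<^bsub>V\<^sub>k w\<^esub>\<close>: the multiplications \<open>M\<^bsub>b j\<^esub>\<close> commute with it, and moving it past \<open>V\<^sub>j\<close> replaces \<open>w\<close> by
  \<open>V\<^sub>j w\<close>, so that the \<open>j\<close>-th term of \<open>A\<close> contributes \<open>M\<^bsub>b j\<^esub> M\<^bsub>V\<^sub>k(V\<^sub>j w - w)\<^esub> V\<^sub>j x\<close> to the commutator applied
  to \<open>x\<close> (lemma \<open>commutator_term\<close>). By the summation formula with \<open>u = V\<^sub>j w - w\<close>, the \<open>\<ell>\<^sup>2\<close>-norm in
  \<open>k\<close> of this contribution is at most \<open>\<parallel>b j\<parallel>\<^sub>\<infinity> \<parallel>V\<^sub>j w - w\<parallel> \<parallel>x\<parallel>\<close>. Adding up over \<open>j\<close> with Minkowski's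
  inequality,
  \<open>(\<Sum>\<^sub>k \<parallel>A (M\<^bsub>V\<^sub>k w\<^esub> x)\<parallel>\<^sup>2)\<^sup>1\<^sup>/\<^sup>2 \<le> (\<parallel>A x\<parallel> / \<parallel>x\<parallel> + \<epsilon>(w, A)) \<parallel>w\<parallel> \<parallel>x\<parallel>\<close>,
  and the right-hand side is \<open>\<parallel>A x\<parallel> / \<parallel>x\<parallel> + \<epsilon>(w, A)\<close> times \<open>(\<Sum>\<^sub>k \<parallel>M\<^bsub>V\<^sub>k w\<^esub> x\<parallel>\<^sup>2)\<^sup>1\<^sup>/\<^sup>2\<close>. If the claimed inequality
  failed for all \<open>k\<close> with \<open>M\<^bsub>V\<^sub>k w\<^esub> x \<noteq> 0\<close>, then the opposite strict inequality would follow.\<close>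


section \<open>Norms on \<open>\<ell>\<^sup>2(G, Y)\<close>\<close>

lemma ell2_eqI: "(\<And>i. Rep_ell2 x i = Rep_ell2 y i) \<Longrightarrow> x = y"
  by (rule Rep_ell2_inject[THEN iffD1], rule ext)

lemma has_sum_norm_sq:
  "((\<lambda>i. (norm (Rep_ell2 x i))\<^sup>2) has_sum (norm x)\<^sup>2) UNIV"
proof -
  have s: "(\<lambda>i. (norm (Rep_ell2 x i))\<^sup>2) summable_on UNIV"
    using Rep_ell2[of x] by (simp add: square_summable_def)
  have "(norm x)\<^sup>2 = (\<Sum>\<^sub>\<infinity>i. (norm (Rep_ell2 x i))\<^sup>2)"
    by (simp add: norm_ell2.rep_eq norm2_def infsum_nonneg)
  then show ?thesis
    using has_sum_infsum[OF s] by simp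
qed

lemma norm_shift_op [simp]: "norm (blinfun_apply (shift_op j) x) = norm x"
  for x :: "('g::ab_group_add, 'y::real_normed_vector) ell2"
proof -
  have bij: "bij_betw (\<lambda>i. i - j) UNIV UNIV"
    by (rule bij_betw_byWitness[where f' = "\<lambda>i. i + j"]) auto
  have "((\<lambda>i. (norm (Rep_ell2 (blinfun_apply (shift_op j) x) i))\<^sup>2) has_sum (norm x)\<^sup>2) UNIV"
    using has_sum_reindex_bij_betw[OF bij, of "\<lambda>i. (norm (Rep_ell2 x i))\<^sup>2"] has_sum_norm_sq[of x]
    by (simp add: shift_op_apply)
  then have "(norm (blinfun_apply (shift_op j) x))\<^sup>2 = (norm x)\<^sup>2"
    by (rule has_sum_unique[OF has_sum_norm_sq])
  then show ?thesis
    by simp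
qed

lemma linf_norm_bound:
  assumes "b \<in> linf"
  shows "norm (b i) \<le> linf_norm b" and "0 \<le> linf_norm b"
proof -
  have "bdd_above (range (\<lambda>i. norm (b i)))"
    using assms by (auto simp: linf_def bounded_iff bdd_above_def)
  then show *: "norm (b i) \<le> linf_norm b" for i
    unfolding linf_norm_def by (rule cSUP_upper[OF UNIV_I])
  show "0 \<le> linf_norm b"
    by (rule order_trans[OF norm_ge_zero *])
qed

lemma norm_mult_op_le:
  fixes b :: "'g \<Rightarrow> 'y::complex_inner \<Rightarrow>\<^sub>L 'y"
  assumes "b \<in> linf"
  shows "norm (blinfun_apply (mult_op b) x) \<le> linf_norm b * norm x"
proof -
  have bd: "bounded (range b)"
    using assms by (simp add: linf_def)
  show ?thesis
    unfolding norm_ell2.rep_eq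
  proof (rule square_summable_dominated(2))
    show "square_summable (Rep_ell2 x)"
      using Rep_ell2[of x] by simp
    show "norm (Rep_ell2 (blinfun_apply (mult_op b) x) i) \<le> linf_norm b * norm (Rep_ell2 x i)" for i
      unfolding mult_op_apply[OF bd]
      by (rule order_trans[OF norm_blinfun mult_right_mono[OF linf_norm_bound(1)[OF assms]]]) simp
  qed (rule linf_norm_bound(2)[OF assms])
qed


section \<open>Localization by a sliding window\<close>

definition localize ::
    "('g::ab_group_add, complex) ell2 \<Rightarrow> 'g \<Rightarrow> ('g, 'y::complex_inner) ell2 \<Rightarrow>\<^sub>L ('g, 'y) ell2"
  where "localize u k = scalar_mult_op (Rep_ell2 (blinfun_apply (shift_op k) u))"

lemma localize_apply:
  "Rep_ell2 (blinfun_apply (localize u k) x) i = scaleC (Rep_ell2 u (i - k)) (Rep_ell2 x i)"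
  unfolding localize_def by (simp add: scalar_mult_op_apply[OF bounded_range_ell2] shift_op_apply)

text \<open>The double sum of \<open>\<bar>u (i - k)\<bar>\<^sup>2 \<parallel>x i\<parallel>\<^sup>2\<close> factors if \<open>k\<close> is summed before \<open>i\<close>, because
  \<open>k \<mapsto> i - k\<close> permutes the group. By Tonelli the order does not matter.\<close>

lemma has_sum_norm_localize_sq:
  fixes x :: "('g::ab_group_add, 'y::complex_inner) ell2"
  shows "((\<lambda>k. (norm (blinfun_apply (localize u k) x))\<^sup>2) has_sum (norm u * norm x)\<^sup>2) UNIV"
proof -
  define f where "f = (\<lambda>(i, k). (cmod (Rep_ell2 u (i - k)))\<^sup>2 * (norm (Rep_ell2 x i))\<^sup>2)"
  have bij: "bij_betw (\<lambda>k. i - k) UNIV UNIV" for i :: 'g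
    by (rule bij_betw_byWitness[where f' = "\<lambda>k. i - k"]) auto
  have over_k: "((\<lambda>k. f (i, k)) has_sum (norm u)\<^sup>2 * (norm (Rep_ell2 x i))\<^sup>2) UNIV" for i
    using has_sum_reindex_bij_betw[OF bij, of "\<lambda>k. (cmod (Rep_ell2 u k))\<^sup>2"] has_sum_norm_sq[of u]
    by (auto simp: f_def intro!: has_sum_cmult_left)
  have over_i: "((\<lambda>i. (norm u)\<^sup>2 * (norm (Rep_ell2 x i))\<^sup>2) has_sum (norm u)\<^sup>2 * (norm x)\<^sup>2) UNIV"
    by (rule has_sum_cmult_right[OF has_sum_norm_sq])
  have "f summable_on UNIV \<times> UNIV"
    by (rule summable_on_SigmaI[OF over_k]) (use over_i in \<open>auto simp: f_def summable_on_def\<close>)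
  then have "(f has_sum (norm u)\<^sup>2 * (norm x)\<^sup>2) (UNIV \<times> UNIV)"
    by (rule has_sum_SigmaI[OF over_k over_i])
  then have swapped: "((\<lambda>(k, i). f (i, k)) has_sum (norm u)\<^sup>2 * (norm x)\<^sup>2) (UNIV \<times> UNIV)"
    by (rule has_sum_swap[THEN iffD1])
  have over_i': "((\<lambda>i. f (i, k)) has_sum (norm (blinfun_apply (localize u k) x))\<^sup>2) UNIV" for k
    using has_sum_norm_sq[of "blinfun_apply (localize u k) x"]
    by (simp add: f_def localize_apply norm_scaleC power_mult_distrib)
  show ?thesis
    unfolding power_mult_distrib[of "norm u"]
    by (rule has_sum_SigmaD[OF swapped]) (simp only: prod.case over_i')
qed

lemma L2_set_norm_localize_le:
  assumes "finite F"
  shows "L2_set (\<lambda>k. norm (blinfun_apply (localize u k) x)) F \<le> norm u * norm x"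
proof -
  note s = has_sum_norm_localize_sq[of u x]
  have "(\<Sum>k\<in>F. (norm (blinfun_apply (localize u k) x))\<^sup>2) \<le> (norm u * norm x)\<^sup>2"
    using finite_sum_le_infsum[OF has_sum_imp_summable[OF s] assms] infsumI[OF s] by simp
  then show ?thesis
    unfolding L2_set_def by (simp add: real_le_lsqrt)
qed

lemma proj_op_localize:
  assumes "supp w \<subseteq> W"
  shows "blinfun_apply (proj_op W k) (blinfun_apply (localize w k) x) = blinfun_apply (localize w k) x"
proof -
  have b: "bounded (range (indicator ((+) k ` W) :: _ \<Rightarrow> complex))"
    by (auto simp: bounded_iff indicator_def intro!: exI[of _ 1])
  show ?thesis
  proof (rule ell2_eqI)
    fix i
    have "Rep_ell2 w (i - k) = 0" if "i \<notin> (+) k ` W"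
    proof (rule ccontr)
      assume "Rep_ell2 w (i - k) \<noteq> 0"
      then have "k + (i - k) \<in> (+) k ` W"
        using assms by (intro imageI) (auto simp: supp_def)
      then show False
        using that by simp
    qed
    then show "Rep_ell2 (blinfun_apply (proj_op W k) (blinfun_apply (localize w k) x)) i
        = Rep_ell2 (blinfun_apply (localize w k) x) i"
      by (cases "i \<in> (+) k ` W")
        (simp_all add: proj_op_def scalar_mult_op_apply[OF b] localize_apply scaleC_scaleC)
  qed
qed


section \<open>The commutator with a window\<close>

text \<open>At \<open>i\<close>, both terms on the left apply \<open>b i\<close> to a multiple of \<open>x (i - j)\<close>; the factors are
  \<open>w (i - j - k)\<close> and, by complex linearity of \<open>b i\<close>, \<open>w (i - k)\<close>.\<close>

lemma commutator_term:
  fixes b :: "'g::ab_group_add \<Rightarrow> 'y::complex_inner \<Rightarrow>\<^sub>L 'y"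
  assumes "b \<in> linf"
  shows "blinfun_apply (mult_op b o\<^sub>L shift_op j) (blinfun_apply (localize w k) x)
      - blinfun_apply (localize w k) (blinfun_apply (mult_op b o\<^sub>L shift_op j) x)
    = blinfun_apply (mult_op b)
        (blinfun_apply (localize (blinfun_apply (shift_op j) w - w) k) (blinfun_apply (shift_op j) x))"
proof (rule ell2_eqI)
  fix i
  have bd: "bounded (range b)" and
    lin: "blinfun_apply (b i) (scaleC c y) = scaleC c (blinfun_apply (b i) y)" for c y
    using assms by (auto simp: linf_def clinear_ops_def)
  have diff: "scaleC (c - d) y = scaleC c y - scaleC d y" for c d and y :: 'y
    using scaleC_add_left[of "c - d" d y] by simp
  show "Rep_ell2 (blinfun_apply (mult_op b o\<^sub>L shift_op j) (blinfun_apply (localize w k) x)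
      - blinfun_apply (localize w k) (blinfun_apply (mult_op b o\<^sub>L shift_op j) x)) i
    = Rep_ell2 (blinfun_apply (mult_op b)
        (blinfun_apply (localize (blinfun_apply (shift_op j) w - w) k) (blinfun_apply (shift_op j) x))) i"
    using lin by (simp add: minus_ell2.rep_eq mult_op_apply[OF bd] localize_apply shift_op_apply diff
        blinfun.diff_right add_ac diff_diff_eq)
qed

text \<open>Minkowski's inequality for infinitely many summands passes from partial sums to the limit,
  since for finite \<open>F\<close> the norm \<open>L2_set\<close> is continuous in its finitely many entries.\<close>

lemma L2_set_norm_has_sum_le:
  fixes D :: "'j \<Rightarrow> 'k \<Rightarrow> 'a::real_normed_vector"
  assumes S: "\<And>k. ((\<lambda>j. D j k) has_sum S k) UNIV"
    and le: "\<And>j. L2_set (\<lambda>k. norm (D j k)) F \<le> c j"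
    and c: "(c has_sum C) UNIV"
  shows "L2_set (\<lambda>k. norm (S k)) F \<le> C"
proof (rule tendsto_upperbound)
  show "((\<lambda>J. L2_set (\<lambda>k. norm (\<Sum>j\<in>J. D j k)) F) \<longlongrightarrow> L2_set (\<lambda>k. norm (S k)) F)
      (finite_subsets_at_top UNIV)"
    unfolding L2_set_def using S by (intro tendsto_intros) (simp add: has_sum_def)
  have c0: "0 \<le> c j" for j
    by (rule order_trans[OF L2_set_nonneg le])
  have "L2_set (\<lambda>k. norm (\<Sum>j\<in>J. D j k)) F \<le> sum c J" if "finite J" for J
    using that
  proof induction
    case empty
    then show ?case
      by (simp add: L2_set_def)
  next
    case (insert j J)
    have "L2_set (\<lambda>k. norm (\<Sum>j\<in>insert j J. D j k)) F
        \<le> L2_set (\<lambda>k. norm (D j k) + norm (\<Sum>j\<in>J. D j k)) F"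
      using insert.hyps by (intro L2_set_mono) (auto simp: norm_triangle_ineq)
    also have "\<dots> \<le> L2_set (\<lambda>k. norm (D j k)) F + L2_set (\<lambda>k. norm (\<Sum>j\<in>J. D j k)) F"
      by (rule L2_set_triangle_ineq)
    also have "\<dots> \<le> sum c (insert j J)"
      using insert by (simp add: add_mono le)
    finally show ?case .
  qed
  moreover have "sum c J \<le> C" if "finite J" for J
    using finite_sum_le_infsum[OF has_sum_imp_summable[OF c] that] infsumI[OF c] c0 by simp
  ultimately show "\<forall>\<^sub>F J in finite_subsets_at_top UNIV. L2_set (\<lambda>k. norm (\<Sum>j\<in>J. D j k)) F \<le> C"
    by (intro eventually_finite_subsets_at_top_weakI) (blast intro: order_trans)
qed simp

text \<open>The series converges because shifts are isometric, so that \<open>\<parallel>V\<^sub>j w - w\<parallel> \<le> 2 \<parallel>w\<parallel>\<close>. This rules out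
  that the value of \<open>wiener_eps\<close> is the default \<open>0\<close> of a divergent sum.\<close>

lemma wiener_eps_has_sum:
  assumes "wiener_rep A b" and "w \<noteq> 0"
  shows "((\<lambda>j. linf_norm (b j) * (norm (blinfun_apply (shift_op j) w - w) / norm w))
    has_sum wiener_eps w b) UNIV"
proof -
  have b: "b j \<in> linf" for j
    using assms(1) by (simp add: wiener_rep_def)
  have "(\<lambda>j. linf_norm (b j) * 2) summable_on UNIV"
    using assms(1) by (intro summable_on_cmult_left) (simp add: wiener_rep_def)
  then have "(\<lambda>j. linf_norm (b j) * (norm (blinfun_apply (shift_op j) w - w) / norm w)) summable_on UNIV"
  proof (rule summable_on_comparison_test)
    fix j
    have "norm (blinfun_apply (shift_op j) w - w) \<le> 2 * norm w"
      using norm_triangle_ineq4[of "blinfun_apply (shift_op j) w" w] by simp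
    then show "linf_norm (b j) * (norm (blinfun_apply (shift_op j) w - w) / norm w) \<le> linf_norm (b j) * 2"
      using assms(2) by (intro mult_left_mono linf_norm_bound(2)[OF b]) (simp add: field_simps)
  qed (simp add: linf_norm_bound(2)[OF b])
  then show ?thesis
    unfolding wiener_eps_def by (rule has_sum_infsum)
qed

text \<open>Evaluation at \<open>x\<close> turns the norm convergent series for \<open>A\<close> into one for the commutator, and
  Minkowski's inequality in \<open>k\<close> bounds it term by term. Partial sums over finite \<open>F\<close> stand in for
  the full \<open>\<ell>\<^sup>2\<close>-norm in \<open>k\<close>, whose finiteness is part of what has to be proved.\<close>

lemma L2_set_norm_commutator_le:
  assumes A: "wiener_rep A b" and w: "w \<noteq> 0" and F: "finite F"
  shows "L2_set (\<lambda>k. norm (blinfun_apply A (blinfun_apply (localize w k) x)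
      - blinfun_apply (localize w k) (blinfun_apply A x))) F \<le> wiener_eps w b * (norm w * norm x)"
proof (rule L2_set_norm_has_sum_le)
  have b: "b j \<in> linf" for j
    using A by (simp add: wiener_rep_def)
  let ?B = "\<lambda>j. mult_op (b j) o\<^sub>L shift_op j"
  let ?d = "\<lambda>j. blinfun_apply (shift_op j) w - w"
  show "((\<lambda>j. blinfun_apply (?B j) (blinfun_apply (localize w k) x)
        - blinfun_apply (localize w k) (blinfun_apply (?B j) x))
      has_sum (blinfun_apply A (blinfun_apply (localize w k) x)
        - blinfun_apply (localize w k) (blinfun_apply A x))) UNIV" for k
    using A
    by (intro has_sum_bounded_linear[where f = ?B and S = A and h = "\<lambda>T.
        blinfun_apply T (blinfun_apply (localize w k) x) - blinfun_apply (localize w k) (blinfun_apply T x)"])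
      (auto simp: wiener_rep_def intro!: bounded_linear_intros)
  show "((\<lambda>j. linf_norm (b j) * (norm (?d j) / norm w) * (norm w * norm x))
      has_sum wiener_eps w b * (norm w * norm x)) UNIV"
    by (rule has_sum_cmult_left[OF wiener_eps_has_sum[OF A w]])
  fix j
  have "L2_set (\<lambda>k. norm (blinfun_apply (?B j) (blinfun_apply (localize w k) x)
        - blinfun_apply (localize w k) (blinfun_apply (?B j) x))) F
      \<le> L2_set (\<lambda>k. linf_norm (b j)
          * norm (blinfun_apply (localize (?d j) k) (blinfun_apply (shift_op j) x))) F"
    unfolding commutator_term[OF b] by (intro L2_set_mono norm_mult_op_le[OF b] norm_ge_zero)
  also have "\<dots> = linf_norm (b j)
      * L2_set (\<lambda>k. norm (blinfun_apply (localize (?d j) k) (blinfun_apply (shift_op j) x))) F"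
    by (simp add: L2_set_right_distrib linf_norm_bound(2)[OF b])
  also have "\<dots> \<le> linf_norm (b j) * (norm (?d j) * norm (blinfun_apply (shift_op j) x))"
    by (intro mult_left_mono L2_set_norm_localize_le F linf_norm_bound(2)[OF b])
  also have "\<dots> = linf_norm (b j) * (norm (?d j) / norm w) * (norm w * norm x)"
    using w by simp
  finally show "L2_set (\<lambda>k. norm (blinfun_apply (?B j) (blinfun_apply (localize w k) x)
        - blinfun_apply (localize w k) (blinfun_apply (?B j) x))) F
      \<le> linf_norm (b j) * (norm (?d j) / norm w) * (norm w * norm x)" .
qed

lemma L2_set_norm_wiener_localize_le:
  assumes A: "wiener_rep A b" and w: "w \<noteq> 0" and x: "x \<noteq> 0" and F: "finite F"
  shows "L2_set (\<lambda>k. norm (blinfun_apply A (blinfun_apply (localize w k) x))) F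
    \<le> (norm (blinfun_apply A x) / norm x + wiener_eps w b) * (norm w * norm x)"
proof -
  let ?c = "\<lambda>k. blinfun_apply A (blinfun_apply (localize w k) x)
      - blinfun_apply (localize w k) (blinfun_apply A x)"
  have "L2_set (\<lambda>k. norm (blinfun_apply A (blinfun_apply (localize w k) x))) F
      \<le> L2_set (\<lambda>k. norm (blinfun_apply (localize w k) (blinfun_apply A x)) + norm (?c k)) F"
    by (intro L2_set_mono norm_triangle_sub norm_ge_zero)
  also have "\<dots> \<le> L2_set (\<lambda>k. norm (blinfun_apply (localize w k) (blinfun_apply A x))) F
      + L2_set (\<lambda>k. norm (?c k)) F"
    by (rule L2_set_triangle_ineq)
  also have "\<dots> \<le> norm w * norm (blinfun_apply A x) + wiener_eps w b * (norm w * norm x)"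
    by (intro add_mono L2_set_norm_localize_le L2_set_norm_commutator_le A w F)
  also have "\<dots> = (norm (blinfun_apply A x) / norm x + wiener_eps w b) * (norm w * norm x)"
    using x by (simp add: distrib_right)
  finally show ?thesis .
qed


section \<open>Localization of the quotient\<close>

text \<open>Otherwise \<open>C \<parallel>f k\<parallel> < \<parallel>g k\<parallel>\<close> wherever \<open>f\<close> does not vanish, and \<open>C \<parallel>f k\<parallel> \<le> \<parallel>g k\<parallel>\<close> trivially elsewhere.
  Since \<open>N \<noteq> 0\<close> forces \<open>f\<close> to have a nonzero entry, summing the squares gives \<open>C N < \<parallel>g\<parallel>\<close> in
  \<open>\<ell>\<^sup>2\<close>, contrary to the bound on the partial sums.\<close>

lemma exists_quotient_le_norm2_bound:
  assumes f: "((\<lambda>k. (norm (f k))\<^sup>2) has_sum N\<^sup>2) UNIV" and N: "N \<noteq> 0" and C: "0 \<le> C"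
    and g: "\<And>F. finite F \<Longrightarrow> L2_set (\<lambda>k. norm (g k)) F \<le> C * N"
  shows "\<exists>k. f k \<noteq> 0 \<and> norm (g k) / norm (f k) \<le> C"
proof (rule ccontr)
  assume all: "\<not> ?thesis"
  have strict: "C * norm (f k) < norm (g k)" if "f k \<noteq> 0" for k
  proof -
    have "C < norm (g k) / norm (f k)"
      using all that by (meson not_le)
    then show ?thesis
      using that by (simp add: pos_less_divide_eq)
  qed
  then have le: "(C * norm (f k))\<^sup>2 \<le> (norm (g k))\<^sup>2" for k
    using C by (cases "f k = 0") (auto intro!: power_mono simp: less_imp_le)
  have "\<exists>k. f k \<noteq> 0"
  proof (rule ccontr)
    assume "\<not> ?thesis"
    then have "((\<lambda>k. 0) has_sum N\<^sup>2) (UNIV :: 'a set)"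
      using f by simp
    then show False
      using N has_sum_unique[OF has_sum_0, of UNIV "\<lambda>_. 0" "N\<^sup>2"] by simp
  qed
  then obtain k where k: "f k \<noteq> 0" ..
  have "((\<lambda>k. (C * norm (f k))\<^sup>2) has_sum (C * N)\<^sup>2) UNIV"
    unfolding power_mult_distrib by (rule has_sum_cmult_right[OF f])
  moreover have "((\<lambda>k. (norm (g k))\<^sup>2) has_sum (norm2 g)\<^sup>2) UNIV"
    using has_sum_infsum[OF square_summable_bound(1)[OF g, unfolded square_summable_def]]
    by (simp add: norm2_def infsum_nonneg)
  ultimately have "(C * N)\<^sup>2 < (norm2 g)\<^sup>2"
  proof (rule has_sum_strict_mono)
    show "(C * norm (f k))\<^sup>2 < (norm (g k))\<^sup>2"
      using strict[OF k] C by (intro power_strict_mono) auto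
  qed (simp_all only: le UNIV_I)
  also have "\<dots> \<le> (C * N)\<^sup>2"
    by (intro power_mono square_summable_bound(2)[OF g] norm2_nonneg)
  finally show False
    by simp
qed

theorem proposition5p1:
  fixes A :: "('g::{ab_group_add, countable}, 'y::complex_hilbert) ell2 \<Rightarrow>\<^sub>L ('g, 'y) ell2"
    and b :: "'g \<Rightarrow> 'g \<Rightarrow> 'y \<Rightarrow>\<^sub>L 'y"
    and W :: "'g set"
    and w :: "('g, complex) ell2"
  assumes "wiener_rep A b"
    and "finite W"
    and "w \<noteq> 0"
    and "supp w \<subseteq> W"
  shows "\<forall>x. x \<noteq> 0 \<longrightarrow>
    (\<exists>k. let A\<^sub>k = A o\<^sub>L proj_op W k;
             x\<^sub>k = blinfun_apply (scalar_mult_op (Rep_ell2 (blinfun_apply (shift_op k) w))) x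
         in x\<^sub>k \<noteq> 0 \<and>
            norm (blinfun_apply A\<^sub>k x\<^sub>k) / norm x\<^sub>k
              \<le> norm (blinfun_apply A x) / norm x + wiener_eps w b)"
proof (intro allI impI)
  fix x :: "('g, 'y) ell2"
  assume x: "x \<noteq> 0"
  let ?C = "norm (blinfun_apply A x) / norm x + wiener_eps w b"
  have "b j \<in> linf" for j
    using assms(1) by (simp add: wiener_rep_def)
  then have "0 \<le> ?C"
    unfolding wiener_eps_def by (intro add_nonneg_nonneg infsum_nonneg) (simp_all add: linf_norm_bound(2))
  then have "\<exists>k. blinfun_apply (localize w k) x \<noteq> 0 \<and>
      norm (blinfun_apply A (blinfun_apply (localize w k) x)) / norm (blinfun_apply (localize w k) x) \<le> ?C"
    using assms(3) x
    by (intro exists_quotient_le_norm2_bound[OF has_sum_norm_localize_sq]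
        L2_set_norm_wiener_localize_le[OF assms(1)]) simp_all
  then show "\<exists>k. let A\<^sub>k = A o\<^sub>L proj_op W k;
             x\<^sub>k = blinfun_apply (scalar_mult_op (Rep_ell2 (blinfun_apply (shift_op k) w))) x
         in x\<^sub>k \<noteq> 0 \<and> norm (blinfun_apply A\<^sub>k x\<^sub>k) / norm x\<^sub>k \<le> ?C"
    unfolding Let_def localize_def[symmetric] by (simp add: proj_op_localize[OF assms(4)])
qed

end
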